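(* Let $\mathcal{M}:(\mathbf{X},\mathbf{A})\to\widehat{Y}\in\{0,1\}$ be a binary classifier. Let $\mathbf{a}_{\max}=\operatorname{arg\,max}_{\mathbf{a}}\Pr[\widehat{Y}=1\mid\mathbf{A}=\mathbf{a}]$ and $\mathbf{a}_{\min}=\operatorname{arg\,min}_{\mathbf{a}}\Pr[\widehat{Y}=1\mid\mathbf{A}=\mathbf{a}]$ be the most and the least favored sensitive groups, respectively. If $\Pr[\widehat{Y}=0\mid\mathbf{A}=\mathbf{a}_{\max}]\neq 0$ and $\Pr[\widehat{Y}=0\mid\mathbf{A}=\mathbf{a}_{\min}]\neq 0$, then the statistical parity of $\mathcal{M}$ on $\mathbf{D}$ satisfies \[ f_{\mathsf{SP}}(\mathcal{M},\mathbf{D})=\frac{\mathsf{Var}[\widehat{Y}=1\mid\mathbf{A}=\mathbf{a}_{\max}]}{\Pr[\widehat{Y}=0\mid\mathbf{A}=\mathbf{a}_{\max}]}-\frac{\mathsf{Var}[\widehat{Y}=1\mid\mathbf{A}=\mathbf{a}_{\min}]}{\Pr[\widehat{Y}=0\mid\mathbf{A}=\mathbf{a}_{\min}]}. \]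
   Context: A data point has a random feature vector $\mathbf{Z}=(\mathbf{X},\mathbf{A})$, where $\mathbf{X}$ is the vector of non-sensitive (real-valued) features and $\mathbf{A}$ is the vector of sensitive (categorical) features. $\mathbf{D}$ denotes the dataset, and probabilities are with respect to the distribution of its data points. The values $\mathbf{a}$ of $\mathbf{A}$ are called sensitive groups; there are finitely many and each has positive probability. A binary classifier is a function $\mathcal{M}$ of $(\mathbf{X},\mathbf{A})$, and $\widehat{Y}=\mathcal{M}(\mathbf{X},\mathbf{A})\in\{0,1\}$ is the predicted class. The statistical parity is \[ f_{\mathsf{SP}}(\mathcal{M},\mathbf{D})=\max_{\mathbf{a}}\Pr[\widehat{Y}=1\mid\mathbf{A}=\mathbf{a}]-\min_{\mathbf{a}}\Pr[\widehat{Y}=1\mid\mathbf{A}=\mathbf{a}]. \] $\mathsf{Var}[\widehat{Y}=1\mid\mathbf{A}=\mathbf{a}]$ denotes the variance of the indicator random variable $\mathbf{1}[\widehat{Y}=1]$ under the conditional distribution given $\mathbf{A}=\mathbf{a}$ (the "conditional positive prediction", CPP). If the maximizer or the minimizer is not unique, any choice is allowed. *)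

theory Defs
  imports "HOL-Probability.Probability"
begin

text \<open>
  A data point is a pair \<open>z = (x, a)\<close>, and the dataset enters through the law \<open>D\<close> of its data
  points, so \<open>\<^bold>X\<close> and \<open>\<^bold>A\<close> are \<open>fst\<close> and \<open>snd\<close> on the probability space \<open>D\<close>. The categories of all
  sensitive features share the unconstrained type \<open>'c\<close>; which combinations of categories occur
  is determined by \<open>space D\<close>.
\<close>

type_synonym ('n, 'c, 'k) data_point = "(real ^ 'n) \<times> ('c ^ 'k)"

definition sensitive_groups :: "('n::finite, 'c, 'k::finite) data_point measure \<Rightarrow> ('c ^ 'k) set"
  where "sensitive_groups D = snd ` space D"

locale data_distribution = prob_space D
  for D :: "('n::finite, 'c, 'k::finite) data_point measure" +
  assumes sets_D: "sets D = sets (borel \<Otimes>\<^sub>M count_space (sensitive_groups D))"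
    and finite_groups: "finite (sensitive_groups D)"
    and group_pos: "a \<in> sensitive_groups D \<Longrightarrow> \<P>(z in D. snd z = a) > 0"

definition binary_classifier ::
    "('n::finite, 'c, 'k::finite) data_point measure \<Rightarrow> (('n, 'c, 'k) data_point \<Rightarrow> nat) \<Rightarrow> bool"
  where "binary_classifier D \<M> \<longleftrightarrow> \<M> \<in> measurable D (count_space {0, 1})"

definition group_pred_prob ::
    "(('n::finite, 'c, 'k::finite) data_point \<Rightarrow> nat) \<Rightarrow> ('n, 'c, 'k) data_point measure
      \<Rightarrow> nat \<Rightarrow> 'c ^ 'k \<Rightarrow> real"
  where "group_pred_prob \<M> D y a = \<P>(z in D. \<M> z = y \<bar> snd z = a)"

definition statistical_parity ::
    "(('n::finite, 'c, 'k::finite) data_point \<Rightarrow> nat) \<Rightarrow> ('n, 'c, 'k) data_point measure \<Rightarrow> real"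
  where "statistical_parity \<M> D =
    (MAX a\<in>sensitive_groups D. group_pred_prob \<M> D 1 a)
    - (MIN a\<in>sensitive_groups D. group_pred_prob \<M> D 1 a)"

text \<open>\<open>uniform_measure D S\<close> is \<open>D\<close> conditioned on the event \<open>S\<close>.\<close>

definition group_distribution ::
    "('n::finite, 'c, 'k::finite) data_point measure \<Rightarrow> 'c ^ 'k \<Rightarrow> ('n, 'c, 'k) data_point measure"
  where "group_distribution D a = uniform_measure D {z \<in> space D. snd z = a}"

definition group_pred_variance ::
    "(('n::finite, 'c, 'k::finite) data_point \<Rightarrow> nat) \<Rightarrow> ('n, 'c, 'k) data_point measure
      \<Rightarrow> nat \<Rightarrow> 'c ^ 'k \<Rightarrow> real"
  where "group_pred_variance \<M> D y a =
    prob_space.variance (group_distribution D a) (indicator {z. \<M> z = y})"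

end

theory Submission
  imports Defs
begin

text \<open>Conditioned on a sensitive group, the indicator of a positive prediction is a Bernoulli
  variable. With success probability p its variance is p * (1 - p), and 1 - p is the probability of
  predicting 0 in that group. Dividing the variance by this nonzero probability therefore gives back
  p. Doing so for a most and a least favored group turns the right-hand side into the difference of
  the extreme values of p, which is statistical parity. The work lies in
  \<open>group_pred_variance_eq\<close>, the Bernoulli formula under the conditional law, and in
  \<open>statistical_parity_eq\<close>, which identifies the maximum and minimum with the values at
  the chosen groups.\<close>

lemma (in prob_space) variance_indicator:
  assumes "A \<inter> space M \<in> events"
  shows "variance (indicator A :: 'a \<Rightarrow> real) = prob (A \<inter> space M) * (1 - prob (A \<inter> space M))"
proof -
  have int: "integrable M (indicator A :: 'a \<Rightarrow> real)"
    using assms by (simp add: integrable_indicator_iff emeasure_finite less_top[symmetric])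
  \<comment> \<open>An indicator equals its own square, so its second moment is its mean and the
    variance is p - p^2.\<close>
  have sq: "(indicator A x :: real)\<^sup>2 = indicator A x" for x
    by (simp add: indicator_def)
  have "variance (indicator A :: 'a \<Rightarrow> real) = expectation (indicator A) - (expectation (indicator A))\<^sup>2"
    using variance_eq[OF int] int unfolding sq by simp
  then show ?thesis
    by (simp add: power2_eq_square algebra_simps)
qed

context data_distribution
begin

lemma space_D: "space D = UNIV \<times> sensitive_groups D"
  using sets_eq_imp_space_eq[OF sets_D] by (simp add: space_pair_measure)

lemma group_event:
  assumes "a \<in> sensitive_groups D"
  shows "{z \<in> space D. snd z = a} \<in> events"
proof -
  have "{z \<in> space D. snd z = a} = UNIV \<times> {a}"
    using assms by (auto simp: space_D)
  then show ?thesis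
    using assms by (simp add: sets_D pair_measureI)
qed

lemma prediction_event:
  assumes "binary_classifier D \<M>" "y \<in> {0, 1}"
  shows "{z \<in> space D. \<M> z = y} \<in> events"
proof -
  have "\<M> -` {y} \<inter> space D \<in> events"
    using assms unfolding binary_classifier_def by (intro measurable_sets) auto
  moreover have "\<M> -` {y} \<inter> space D = {z \<in> space D. \<M> z = y}"
    by auto
  ultimately show ?thesis by simp
qed

text \<open>Positive mass of each group is what allows normalizing \<open>D\<close> restricted to
  it.\<close>

lemma prob_space_group_distribution:
  assumes "a \<in> sensitive_groups D"
  shows "prob_space (group_distribution D a)"
  unfolding group_distribution_def
  using group_pos[OF assms] by (intro prob_space_uniform_measure) (auto simp: emeasure_eq_measure)

text \<open>This links the quotient form of conditional probability to the conditional law, so that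
  general facts about probability spaces apply to \<open>group_pred_prob\<close>.\<close>

lemma group_pred_prob_eq:
  assumes "binary_classifier D \<M>" "a \<in> sensitive_groups D" "y \<in> {0, 1}"
  shows "group_pred_prob \<M> D y a = measure (group_distribution D a) {z \<in> space D. \<M> z = y}"
proof -
  have "measure (group_distribution D a) {z \<in> space D. \<M> z = y}
      = prob ({z \<in> space D. snd z = a} \<inter> {z \<in> space D. \<M> z = y}) / prob {z \<in> space D. snd z = a}"
    unfolding group_distribution_def using group_pos[OF assms(2)]
    by (intro measure_uniform_measure)
      (auto simp: emeasure_eq_measure prediction_event[OF assms(1,3)])
  moreover have "{z \<in> space D. snd z = a} \<inter> {z \<in> space D. \<M> z = y}
      = {z \<in> space D. \<M> z = y \<and> snd z = a}"
    by auto
  ultimately show ?thesis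
    by (simp add: group_pred_prob_def cond_prob_def)
qed

lemma group_pred_prob_complement:
  assumes "binary_classifier D \<M>" "a \<in> sensitive_groups D"
  shows "group_pred_prob \<M> D 0 a = 1 - group_pred_prob \<M> D 1 a"
proof -
  interpret G: prob_space "group_distribution D a"
    using prob_space_group_distribution[OF assms(2)] .
  have space: "space (group_distribution D a) = space D"
    and sets: "sets (group_distribution D a) = sets D"
    by (simp_all add: group_distribution_def)
  \<comment> \<open>\<open>\<M>\<close> has type \<open>nat\<close>; measurability into
    \<open>{0, 1}\<close> is what excludes other values on \<open>space D\<close>.\<close>
  have "\<M> z \<in> {0, 1}" if "z \<in> space D" for z
    using measurable_space[OF assms(1)[unfolded binary_classifier_def] that] by simp
  then have "{z \<in> space D. \<M> z = 0} = space D - {z \<in> space D. \<M> z = 1}"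
    by auto
  then show ?thesis
    using G.prob_compl[of "{z \<in> space D. \<M> z = 1}"] prediction_event[OF assms(1), of 1]
    by (simp add: group_pred_prob_eq[OF assms] space sets)
qed

lemma group_pred_variance_eq:
  assumes "binary_classifier D \<M>" "a \<in> sensitive_groups D"
  shows "group_pred_variance \<M> D 1 a = group_pred_prob \<M> D 1 a * group_pred_prob \<M> D 0 a"
proof -
  interpret G: prob_space "group_distribution D a"
    using prob_space_group_distribution[OF assms(2)] .
  \<comment> \<open>The indicator in the variance ranges over all data points; only its trace on
    \<open>space D\<close> is an event.\<close>
  have "{z. \<M> z = 1} \<inter> space (group_distribution D a) = {z \<in> space D. \<M> z = 1}"
    by (auto simp: group_distribution_def)
  moreover have "{z \<in> space D. \<M> z = 1} \<in> G.events"
    using prediction_event[OF assms(1), of 1] by (simp add: group_distribution_def)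
  ultimately show ?thesis
    using G.variance_indicator[of "{z. \<M> z = 1}"]
    by (simp add: group_pred_variance_def group_pred_prob_complement[OF assms] group_pred_prob_eq[OF assms])
qed

text \<open>Over finitely many groups the extremes are attained. Ties are harmless because only the
  values at the extremal groups enter.\<close>

lemma statistical_parity_eq:
  assumes "is_arg_max (group_pred_prob \<M> D 1) (\<lambda>a. a \<in> sensitive_groups D) a_max"
    and "is_arg_min (group_pred_prob \<M> D 1) (\<lambda>a. a \<in> sensitive_groups D) a_min"
  shows "statistical_parity \<M> D = group_pred_prob \<M> D 1 a_max - group_pred_prob \<M> D 1 a_min"
proof -
  have "(MAX a\<in>sensitive_groups D. group_pred_prob \<M> D 1 a) = group_pred_prob \<M> D 1 a_max"
    using assms(1) finite_groups by (intro Max_eqI) (auto simp: is_arg_max_linorder)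
  moreover have "(MIN a\<in>sensitive_groups D. group_pred_prob \<M> D 1 a) = group_pred_prob \<M> D 1 a_min"
    using assms(2) finite_groups by (intro Min_eqI) (auto simp: is_arg_min_linorder)
  ultimately show ?thesis
    by (simp add: statistical_parity_def)
qed

end

theorem lemma1:
  fixes D :: "('n::finite, 'c, 'k::finite) data_point measure"
    and \<M> :: "('n, 'c, 'k) data_point \<Rightarrow> nat"
    and a_max a_min :: "'c ^ 'k"
  assumes "data_distribution D"
    and "binary_classifier D \<M>"
    and "is_arg_max (group_pred_prob \<M> D 1) (\<lambda>a. a \<in> sensitive_groups D) a_max"
    and "is_arg_min (group_pred_prob \<M> D 1) (\<lambda>a. a \<in> sensitive_groups D) a_min"
    and "group_pred_prob \<M> D 0 a_max \<noteq> 0"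
    and "group_pred_prob \<M> D 0 a_min \<noteq> 0"
  shows "statistical_parity \<M> D =
    group_pred_variance \<M> D 1 a_max / group_pred_prob \<M> D 0 a_max
    - group_pred_variance \<M> D 1 a_min / group_pred_prob \<M> D 0 a_min"
proof -
  interpret data_distribution D by fact
  have "a_max \<in> sensitive_groups D" "a_min \<in> sensitive_groups D"
    using assms(3,4) by (auto simp: is_arg_max_def is_arg_min_def)
  then show ?thesis
    using assms(5,6)
    \<comment> \<open>Each quotient p * q / q cancels since q is nonzero. Keeping \<open>1\<close>
      from becoming \<open>Suc 0\<close> lets the variance identity match.\<close>
    by (simp add: statistical_parity_eq[OF assms(3,4)] group_pred_variance_eq[OF assms(2)] del: One_nat_def)
qed

end
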